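(* Assume that $\mathcal I_0=0$ and that $\Psi$ is positively homogeneous in the sense that there exists a convex, strictly decreasing and positive function $\gamma:(0,\infty)\to(0,\infty)$ with $$\Psi(rN)=\gamma(r)\,\Psi(N)\qquad\forall r>0,\ N\in\operatorname{PD}(n).$$ Let $K>0$ and let $\bar\omega_\beta$ be a solution to $(P_\beta)$ for some fixed $\beta>0$. Then $$ K\,\bar\omega_\beta/\|\bar\omega_\beta\|_{M(\Omega_o)}\quad\text{solves}\quad (P^K).$$
   Context: Let $n\in\mathbb N$, $\Omega\subset\mathbb R^d$ a bounded domain, $\Omega_o\subset\bar\Omega$ nonempty and closed (hence compact). $M(\Omega_o)=C(\Omega_o)^*$ is the space of regular signed Borel measures with duality pairing $\langle\cdot,\cdot\rangle$ and total variation norm; $M^+(\Omega_o)$ is the cone of positive measures. $\operatorname{Sym}(n)$, $\operatorname{NND}(n)$, $\operatorname{PD}(n)$ are the symmetric, symmetric positive semidefinite, and symmetric positive definite real $n\times n$ matrices; $A\le_L B$ means $B-A\in\operatorname{NND}(n)$. Let $Q_{ad}\subset\mathbb R^n$ and let $S$ (the parameter-to-state map) be a map with values in $C(\Omega_o)$, continuously differentiable in a neighborhood of $Q_{ad}$; fix $\hat q\in Q_{ad}$ and let $\partial_kS[\hat q]\in C(\Omega_o)$, $k=1,\dots,n$, be its partial derivatives at $\hat q$. Define $\mathcal I:M(\Omega_o)\to\operatorname{Sym}(n)$ by $\mathcal I(\omega)_{kl}=\langle\partial_kS[\hat q]\,\partial_lS[\hat q],\omega\rangle$, and let $\mathcal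 I_0\in\operatorname{NND}(n)$. Let $\Psi:\operatorname{Sym}(n)\to\mathbb R\cup\{+\infty\}$ satisfy: (A1) $\{\Psi<\infty\}=\operatorname{PD}(n)$; (A2) $\Psi$ is continuously differentiable on $\operatorname{PD}(n)$; (A3) $\Psi\ge0$ on $\operatorname{NND}(n)$; (A4) $\Psi$ is lower semicontinuous and convex on $\operatorname{NND}(n)$; (A5) $N_1\le_LN_2\Rightarrow\Psi(N_1)\ge\Psi(N_2)$ for $N_1,N_2\in\operatorname{NND}(n)$. Put $\psi(\omega)=\Psi(\mathcal I(\omega)+\mathcal I_0)$. Problem $(P_\beta)$: minimize $\psi(\omega)+\beta\|\omega\|_{M(\Omega_o)}$ over $\omega\in M^+(\Omega_o)$. Problem $(P^K)$: minimize $\psi(\omega)$ over $\omega\in M^+(\Omega_o)$ subject to $\|\omega\|_{M(\Omega_o)}\le K$. A solution is a minimizer with finite objective value. *)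

theory Defs
  imports "HOL-Analysis.Analysis"
begin

section \<open>Symmetric matrices and the Loewner order\<close>

definition Sym_mats :: "(real^'n^'n) set" where
  "Sym_mats = {A. transpose A = A}"

definition NND_mats :: "(real^'n^'n) set" where
  "NND_mats = {A \<in> Sym_mats. \<forall>v. 0 \<le> v \<bullet> (A *v v)}"

definition PD_mats :: "(real^'n^'n) set" where
  "PD_mats = {A \<in> Sym_mats. \<forall>v. v \<noteq> 0 \<longrightarrow> 0 < v \<bullet> (A *v v)}"

definition loewner_le :: "real^'n^'n \<Rightarrow> real^'n^'n \<Rightarrow> bool" where
  "loewner_le A B \<longleftrightarrow> B - A \<in> NND_mats"


section \<open>Extended-real-valued functions of a matrix\<close>

definition lsc_on :: "'a::topological_space set \<Rightarrow> ('a \<Rightarrow> ereal) \<Rightarrow> bool" where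
  "lsc_on X f \<longleftrightarrow> (\<forall>x\<in>X. f x \<le> Liminf (at x within X) f)"

text \<open>Only meant for functions that avoid the value \<open>-\<infinity>\<close>; recall \<open>0 * \<infinity> = 0\<close> in \<open>ereal\<close>.\<close>

definition ereal_convex_on :: "'a::real_vector set \<Rightarrow> ('a \<Rightarrow> ereal) \<Rightarrow> bool" where
  "ereal_convex_on X f \<longleftrightarrow> convex X \<and>
     (\<forall>x\<in>X. \<forall>y\<in>X. \<forall>t\<in>{0..1}.
        f ((1 - t) *\<^sub>R x + t *\<^sub>R y) \<le> ereal (1 - t) * f x + ereal t * f y)"

text \<open>\<open>PD_mats\<close> is relatively open in the subspace \<open>Sym_mats\<close>, but not open in the space of all
  matrices. Differentiability is therefore taken within \<open>PD_mats\<close>: the derivative is a linear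
  functional whose restriction to \<open>Sym_mats\<close> is the derivative of \<open>\<Psi>\<close>, and whose values on other
  matrices are immaterial.\<close>

definition C1_on_PD :: "(real^'n^'n \<Rightarrow> ereal) \<Rightarrow> bool" where
  "C1_on_PD \<Psi> \<longleftrightarrow> (\<exists>D :: real^'n^'n \<Rightarrow> (real^'n^'n) \<Rightarrow>\<^sub>L real.
     (\<forall>N\<in>PD_mats. ((\<lambda>M. real_of_ereal (\<Psi> M)) has_derivative blinfun_apply (D N))
                     (at N within PD_mats)) \<and>
     continuous_on PD_mats D)"


section \<open>Maps with values in the space of continuous functions on a compact set\<close>

text \<open>
  An element of \<open>C(X)\<close> is represented by a function on the whole space that is continuous on \<open>X\<close>;
  its values outside \<open>X\<close> are irrelevant. Convergence in the maximum norm of \<open>C(X)\<close> is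
  \<^const>\<open>uniform_limit\<close> on \<open>X\<close>.
\<close>

text \<open>\<open>D\<close> is the Frechet derivative at \<open>q\<close> of \<open>S\<close>, regarded as a map into \<open>C(X)\<close>. A linear map out
  of a finite-dimensional space is automatically bounded.\<close>

definition has_C_derivative ::
  "'x::topological_space set \<Rightarrow> (real^'n \<Rightarrow> 'x \<Rightarrow> real) \<Rightarrow> (real^'n \<Rightarrow> 'x \<Rightarrow> real) \<Rightarrow> real^'n \<Rightarrow> bool"
where
  "has_C_derivative X S D q \<longleftrightarrow>
     (\<forall>h. continuous_on X (D h)) \<and> (\<forall>x\<in>X. linear (\<lambda>h. D h x)) \<and>
     uniform_limit X (\<lambda>h x. (S (q + h) x - S q x - D h x) / norm h) (\<lambda>x. 0) (at 0)"

text \<open>Continuity of the derivative is with respect to the operator norm, the supremum over the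
  unit ball of directions \<open>h\<close> of the maximum norm on \<open>X\<close>.\<close>

definition C1_near ::
  "'x::topological_space set \<Rightarrow> (real^'n \<Rightarrow> 'x \<Rightarrow> real) \<Rightarrow> (real^'n) set \<Rightarrow> bool"
where
  "C1_near X S Q \<longleftrightarrow> (\<exists>U D. open U \<and> Q \<subseteq> U \<and>
     (\<forall>q\<in>U. continuous_on X (S q) \<and> has_C_derivative X S (D q) q) \<and>
     (\<forall>q\<in>U. uniform_limit (cball 0 1 \<times> X) (\<lambda>p (h, x). D p h x) (\<lambda>(h, x). D q h x) (at q)))"

definition has_C_partial ::
  "'x::topological_space set \<Rightarrow> (real^'n \<Rightarrow> 'x \<Rightarrow> real) \<Rightarrow> 'n \<Rightarrow> ('x \<Rightarrow> real) \<Rightarrow> real^'n \<Rightarrow> bool"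
where
  "has_C_partial X S k g q \<longleftrightarrow> continuous_on X g \<and>
     uniform_limit X (\<lambda>t x. (S (q + t *\<^sub>R axis k 1) x - S q x) / t) g (at 0)"


section \<open>Regular signed Borel measures\<close>

definition borel_on :: "'x::topological_space set \<Rightarrow> 'x set set" where
  "borel_on X = sets (restrict_space borel X)"

text \<open>The supremum is finite for every finite-valued countably additive \<open>\<omega>\<close>, so it can be taken in
  the reals.\<close>

definition total_variation :: "'x::topological_space set \<Rightarrow> ('x set \<Rightarrow> real) \<Rightarrow> 'x set \<Rightarrow> real" where
  "total_variation X \<omega> A =
     (SUP P \<in> {P. finite P \<and> partition_on A P \<and> P \<subseteq> borel_on X}. \<Sum>E\<in>P. \<bar>\<omega> E\<bar>)"

text \<open>A signed measure is represented by its set function, extended by \<open>0\<close> to sets that are not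
  Borel subsets of \<open>X\<close>. Countable additivity implies \<open>\<omega> {} = 0\<close>.\<close>

definition signed_measures :: "'x::topological_space set \<Rightarrow> ('x set \<Rightarrow> real) set" where
  "signed_measures X = {\<omega>.
     (\<forall>A. A \<notin> borel_on X \<longrightarrow> \<omega> A = 0) \<and>
     (\<forall>A :: nat \<Rightarrow> 'x set. range A \<subseteq> borel_on X \<longrightarrow> disjoint_family A \<longrightarrow>
        (\<lambda>i. \<omega> (A i)) sums \<omega> (\<Union>i. A i)) \<and>
     (\<forall>A \<in> borel_on X. \<forall>\<epsilon>>0. \<exists>C U. compact C \<and> C \<subseteq> A \<and> A \<subseteq> U \<and> openin (top_of_set X) U \<and>
        total_variation X \<omega> (U - C) < \<epsilon>)}"

definition positive_measures :: "'x::topological_space set \<Rightarrow> ('x set \<Rightarrow> real) set" where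
  "positive_measures X = {\<omega> \<in> signed_measures X. \<forall>A. 0 \<le> \<omega> A}"

definition tv_norm :: "'x::topological_space set \<Rightarrow> ('x set \<Rightarrow> real) \<Rightarrow> real" where
  "tv_norm X \<omega> = total_variation X \<omega> X"

text \<open>The Jordan decomposition \<open>\<omega> = \<omega>\<^sup>+ - \<omega>\<^sup>-\<close> with \<open>\<omega>\<^sup>\<plusminus> = (\<bar>\<omega>\<bar> \<plusminus> \<omega>) / 2\<close>.\<close>

definition pos_part :: "'x::topological_space set \<Rightarrow> ('x set \<Rightarrow> real) \<Rightarrow> 'x measure" where
  "pos_part X \<omega> = measure_of X (borel_on X) (\<lambda>A. ennreal ((total_variation X \<omega> A + \<omega> A) / 2))"

definition neg_part :: "'x::topological_space set \<Rightarrow> ('x set \<Rightarrow> real) \<Rightarrow> 'x measure" where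
  "neg_part X \<omega> = measure_of X (borel_on X) (\<lambda>A. ennreal ((total_variation X \<omega> A - \<omega> A) / 2))"

definition pairing :: "'x::topological_space set \<Rightarrow> ('x \<Rightarrow> real) \<Rightarrow> ('x set \<Rightarrow> real) \<Rightarrow> real" where
  "pairing X f \<omega> = (\<integral>x. f x \<partial>pos_part X \<omega>) - (\<integral>x. f x \<partial>neg_part X \<omega>)"


section \<open>The optimal design problems\<close>

text \<open>Here \<open>dS k\<close> stands for the partial derivative \<open>\<partial>\<^sub>k S[q]\<close> at the reference parameter.\<close>

definition info_matrix ::
  "'x::topological_space set \<Rightarrow> ('n \<Rightarrow> 'x \<Rightarrow> real) \<Rightarrow> ('x set \<Rightarrow> real) \<Rightarrow> real^'n^'n" where
  "info_matrix X dS \<omega> = (\<chi> k l. pairing X (\<lambda>x. dS k x * dS l x) \<omega>)"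

definition design_obj ::
  "'x::topological_space set \<Rightarrow> ('n \<Rightarrow> 'x \<Rightarrow> real) \<Rightarrow> (real^'n^'n \<Rightarrow> ereal) \<Rightarrow> real^'n^'n
    \<Rightarrow> ('x set \<Rightarrow> real) \<Rightarrow> ereal" where
  "design_obj X dS \<Psi> I0 \<omega> = \<Psi> (info_matrix X dS \<omega> + I0)"

definition is_solution :: "('a \<Rightarrow> ereal) \<Rightarrow> 'a set \<Rightarrow> 'a \<Rightarrow> bool" where
  "is_solution f F \<omega> \<longleftrightarrow> \<omega> \<in> F \<and> \<bar>f \<omega>\<bar> \<noteq> \<infinity> \<and> (\<forall>\<omega>'\<in>F. f \<omega> \<le> f \<omega>')"

definition solves_P_beta ::
  "'x::topological_space set \<Rightarrow> ('n \<Rightarrow> 'x \<Rightarrow> real) \<Rightarrow> (real^'n^'n \<Rightarrow> ereal) \<Rightarrow> real^'n^'n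
    \<Rightarrow> real \<Rightarrow> ('x set \<Rightarrow> real) \<Rightarrow> bool" where
  "solves_P_beta X dS \<Psi> I0 \<beta> \<omega> \<longleftrightarrow>
     is_solution (\<lambda>\<mu>. design_obj X dS \<Psi> I0 \<mu> + ereal (\<beta> * tv_norm X \<mu>)) (positive_measures X) \<omega>"

definition solves_P_K ::
  "'x::topological_space set \<Rightarrow> ('n \<Rightarrow> 'x \<Rightarrow> real) \<Rightarrow> (real^'n^'n \<Rightarrow> ereal) \<Rightarrow> real^'n^'n
    \<Rightarrow> real \<Rightarrow> ('x set \<Rightarrow> real) \<Rightarrow> bool" where
  "solves_P_K X dS \<Psi> I0 K \<omega> \<longleftrightarrow>
     is_solution (design_obj X dS \<Psi> I0) {\<mu> \<in> positive_measures X. tv_norm X \<mu> \<le> K} \<omega>"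

end

theory Submission
  imports Defs
begin

text \<open>
  Write \<open>\<omega>\<close> for the solution of the penalized problem, \<open>m\<close> for its norm and \<open>\<I>\<close> for the
  information matrix, and compare \<open>K \<omega> / m\<close> with a competitor \<open>\<mu>\<close> of norm at most \<open>K\<close>. The rescaled
  competitor \<open>\<nu> = (m / K) \<mu>\<close> is admissible for the penalized problem and has norm at most \<open>m\<close>, so its
  penalty term does not exceed that of \<open>\<omega>\<close>. Minimality of \<open>\<omega>\<close> therefore yields
  \<open>\<Psi> (\<I> \<omega>) \<le> \<Psi> (\<I> \<nu>)\<close>, in which the penalty has disappeared. Multiplying by \<open>\<gamma> (K / m) > 0\<close> and
  applying homogeneity on both sides gives
  \<open>\<Psi> (\<I> (K \<omega> / m)) = \<gamma> (K / m) \<Psi> (\<I> \<omega>) \<le> \<gamma> (K / m) \<Psi> (\<I> \<nu>) = \<Psi> (\<I> \<mu>)\<close>.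
  Homogeneity is available only on positive definite matrices. This is harmless, because \<open>\<Psi>\<close> takes
  the value \<open>\<infinity>\<close> at \<open>\<I> \<mu>\<close> otherwise. The division by \<open>m\<close> is legitimate since a measure of norm zero
  has information matrix \<open>0\<close>, at which the objective is infinite.

  The argument uses that norm and information matrix commute with multiplication by nonnegative
  scalars. Both are defined through suprema over partitions and the Jordan decomposition; on the cone
  of positive measures the variation of a set is just its measure (\<open>total_variation_scale\<close>), so that
  the pairing reduces to an ordinary integral (\<open>pairing_positive\<close>) and scaling becomes transparent.
\<close>

section \<open>Positive measures as measure spaces\<close>

definition borel_measure_of ::
    "'x::topological_space set \<Rightarrow> ('x set \<Rightarrow> real) \<Rightarrow> 'x measure" where
  "borel_measure_of X \<omega> = measure_of X (borel_on X) (\<lambda>A. ennreal (\<omega> A))"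

lemma sigma_algebra_borel_on: "sigma_algebra X (borel_on X)"
  unfolding borel_on_def using sets.sigma_algebra_axioms[of "restrict_space borel X"]
  by (simp add: space_restrict_space)

lemma borel_on_subset: "A \<in> borel_on X \<Longrightarrow> A \<subseteq> X"
proof -
  interpret sigma_algebra X "borel_on X"
    by (rule sigma_algebra_borel_on)
  show "A \<in> borel_on X \<Longrightarrow> A \<subseteq> X"
    by (rule sets_into_space)
qed

lemma sets_borel_measure_of [simp]: "sets (borel_measure_of X \<omega>) = borel_on X"
  unfolding borel_measure_of_def
  by (rule sigma_algebra.sets_measure_of_eq[OF sigma_algebra_borel_on])

lemma space_borel_measure_of [simp]: "space (borel_measure_of X \<omega>) = X"
  unfolding borel_measure_of_def
  by (rule sigma_algebra.space_measure_of_eq[OF sigma_algebra_borel_on])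

lemma positive_measures_nonneg: "\<omega> \<in> positive_measures X \<Longrightarrow> 0 \<le> \<omega> A"
  by (simp add: positive_measures_def)

lemma positive_measures_sums:
  assumes "\<omega> \<in> positive_measures X" "range A \<subseteq> borel_on X" "disjoint_family A"
  shows "(\<lambda>i. \<omega> (A i)) sums \<omega> (\<Union>i. A i)"
  using assms by (simp add: positive_measures_def signed_measures_def)

lemma positive_measures_outside:
  "\<omega> \<in> positive_measures X \<Longrightarrow> A \<notin> borel_on X \<Longrightarrow> \<omega> A = 0"
  by (simp add: positive_measures_def signed_measures_def)

lemma positive_measures_regular:
  assumes "\<omega> \<in> positive_measures X" "A \<in> borel_on X" "0 < \<epsilon>"
  obtains C U where "compact C" "C \<subseteq> A" "A \<subseteq> U" "openin (top_of_set X) U"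
    "total_variation X \<omega> (U - C) < \<epsilon>"
proof -
  have "\<forall>A \<in> borel_on X. \<forall>\<epsilon>>0. \<exists>C U. compact C \<and> C \<subseteq> A \<and> A \<subseteq> U \<and> openin (top_of_set X) U \<and>
      total_variation X \<omega> (U - C) < \<epsilon>"
    using assms(1) by (simp add: positive_measures_def signed_measures_def)
  from this[rule_format, OF assms(2,3)] show ?thesis
    by (elim exE conjE) (rule that)
qed

text \<open>The constant family of empty sets has constant, hence vanishing, summable values.\<close>

lemma positive_measures_empty:
  assumes "\<omega> \<in> positive_measures X"
  shows "\<omega> {} = 0"
proof -
  have "{} \<in> borel_on X"
    unfolding borel_on_def by (rule sets.empty_sets)
  then have "range (\<lambda>_::nat. {}) \<subseteq> borel_on X"
    by blast
  from positive_measures_sums[OF assms this] have "(\<lambda>i::nat. \<omega> {}) sums \<omega> {}"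
    by (simp only: disjoint_family_on_def UN_empty) simp
  then have "summable (\<lambda>i::nat. \<omega> {})"
    by (rule sums_summable)
  then show ?thesis
    by (simp only: summable_const_iff)
qed

lemma emeasure_borel_measure_of:
  assumes "\<omega> \<in> positive_measures X"
  shows "emeasure (borel_measure_of X \<omega>) A = ennreal (\<omega> A)"
proof (cases "A \<in> borel_on X")
  case True
  have "countably_additive (borel_on X) (\<lambda>A. ennreal (\<omega> A))"
    unfolding countably_additive_def
    by (intro allI impI suminf_ennreal_eq positive_measures_sums[OF assms]
        positive_measures_nonneg[OF assms])
  then have "emeasure (measure_of X (borel_on X) (\<lambda>A. ennreal (\<omega> A))) A = ennreal (\<omega> A)"
    using True positive_measures_empty[OF assms]
    by (simp add: emeasure_measure_of_sigma[OF sigma_algebra_borel_on] positive_def)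
  then show ?thesis
    by (simp add: borel_measure_of_def)
next
  case False
  then show ?thesis
    by (simp add: emeasure_notin_sets positive_measures_outside[OF assms])
qed

lemma measure_borel_measure_of:
  "\<omega> \<in> positive_measures X \<Longrightarrow> measure (borel_measure_of X \<omega>) A = \<omega> A"
  by (simp add: measure_def emeasure_borel_measure_of positive_measures_nonneg)

lemma finite_measure_borel_measure_of:
  "\<omega> \<in> positive_measures X \<Longrightarrow> finite_measure (borel_measure_of X \<omega>)"
  by (intro finite_measureI) (simp add: emeasure_borel_measure_of)

section \<open>Total variation and pairing on the positive cone\<close>

lemma sum_finite_partition:
  assumes "\<omega> \<in> positive_measures X" "finite P" "partition_on A P" "P \<subseteq> borel_on X"
  shows "(\<Sum>E\<in>P. \<omega> E) = \<omega> A"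
proof -
  interpret finite_measure "borel_measure_of X \<omega>"
    by (rule finite_measure_borel_measure_of[OF assms(1)])
  have "disjoint_family_on id P" "\<Union>P = A"
    using assms(3) by (auto simp: partition_on_def disjoint_def disjoint_family_on_def)
  then show ?thesis
    using finite_measure_finite_Union[of P id] assms(2,4)
    by (simp add: measure_borel_measure_of[OF assms(1)])
qed

text \<open>By finite additivity all Borel partitions yield the same sum, so the supremum is trivial. The
  scalar is included because the regularity of \<open>c \<omega>\<close> is a condition on the variation of
  \<open>c \<omega>\<close>; it has to be known before \<open>c \<omega>\<close> is recognized as an element of the positive cone.\<close>

lemma total_variation_scale:
  assumes \<omega>: "\<omega> \<in> positive_measures X" and c: "0 \<le> c" and A: "A \<in> borel_on X"
  shows "total_variation X (\<lambda>B. c * \<omega> B) A = c * \<omega> A"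
proof -
  let ?\<P> = "{P. finite P \<and> partition_on A P \<and> P \<subseteq> borel_on X}"
  have "(\<Sum>E\<in>P. \<bar>c * \<omega> E\<bar>) = c * \<omega> A" if "P \<in> ?\<P>" for P
    using sum_finite_partition[OF \<omega>, of P A] that c positive_measures_nonneg[OF \<omega>]
    by (simp add: abs_mult flip: sum_distrib_left)
  moreover have "(if A = {} then {} else {A}) \<in> ?\<P>"
    using A by (simp add: partition_on_def)
  then have "?\<P> \<noteq> {}"
    by blast
  ultimately have "(SUP P\<in>?\<P>. \<Sum>E\<in>P. \<bar>c * \<omega> E\<bar>) = c * \<omega> A"
    by simp
  then show ?thesis
    unfolding total_variation_def .
qed

corollary total_variation_positive:
  assumes "\<omega> \<in> positive_measures X" "A \<in> borel_on X"
  shows "total_variation X \<omega> A = \<omega> A"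
  using total_variation_scale[OF assms(1) _ assms(2), of 1] by simp

lemma whole_space_borel_on: "X \<in> borel_on X"
proof -
  interpret sigma_algebra X "borel_on X"
    by (rule sigma_algebra_borel_on)
  show ?thesis
    by (rule top)
qed

lemma tv_norm_positive: "\<omega> \<in> positive_measures X \<Longrightarrow> tv_norm X \<omega> = \<omega> X"
  by (simp add: tv_norm_def total_variation_positive whole_space_borel_on)

lemma positive_measures_scale:
  fixes X :: "'x::t2_space set"
  assumes \<omega>: "\<omega> \<in> positive_measures X" and c: "0 \<le> c"
  shows "(\<lambda>A. c * \<omega> A) \<in> positive_measures X"
proof -
  interpret sigma_algebra X "borel_on X"
    by (rule sigma_algebra_borel_on)
  have "\<exists>C U. compact C \<and> C \<subseteq> A \<and> A \<subseteq> U \<and> openin (top_of_set X) U \<and>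
      total_variation X (\<lambda>A. c * \<omega> A) (U - C) < \<epsilon>" if A: "A \<in> borel_on X" and "0 < \<epsilon>" for A \<epsilon>
  proof -
    \<comment> \<open>Dividing by \<open>c + 1\<close> rather than \<open>c\<close> treats \<open>c = 0\<close> along with the rest.\<close>
    have "0 < \<epsilon> / (c + 1)"
      using c \<open>0 < \<epsilon>\<close> by simp
    from positive_measures_regular[OF \<omega> A this]
    obtain C U where CU: "compact C" "C \<subseteq> A" "A \<subseteq> U" "openin (top_of_set X) U"
      and small: "total_variation X \<omega> (U - C) < \<epsilon> / (c + 1)" .
    have "U \<in> borel_on X"
      using CU(4) unfolding borel_on_def sets_restrict_space openin_open
      by (elim exE conjE) (rule image_eqI, assumption, rule borel_open)
    moreover have "C = X \<inter> C"
      using CU(2) borel_on_subset[OF A] by blast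
    then have "C \<in> borel_on X"
      unfolding borel_on_def sets_restrict_space
      by (rule image_eqI) (rule borel_compact[OF CU(1)])
    ultimately have UC: "U - C \<in> borel_on X"
      by blast
    have "c * \<omega> (U - C) \<le> (c + 1) * \<omega> (U - C)"
      using positive_measures_nonneg[OF \<omega>] by (simp add: algebra_simps)
    also have "\<dots> < \<epsilon>"
      using small c by (simp add: total_variation_positive[OF \<omega> UC] field_simps)
    finally have "total_variation X (\<lambda>A. c * \<omega> A) (U - C) < \<epsilon>"
      by (simp add: total_variation_scale[OF \<omega> c UC])
    with CU show ?thesis
      by (intro exI[of _ C] exI[of _ U]) simp
  qed
  moreover have "(\<lambda>i. c * \<omega> (A i)) sums (c * \<omega> (\<Union>i. A i))"
    if "range A \<subseteq> borel_on X" "disjoint_family A" for A :: "nat \<Rightarrow> 'x set"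
    using positive_measures_sums[OF \<omega> that] by (rule sums_mult)
  ultimately show ?thesis
    using c positive_measures_nonneg[OF \<omega>] positive_measures_outside[OF \<omega>]
    by (auto simp: positive_measures_def signed_measures_def)
qed

lemma tv_norm_scale:
  fixes X :: "'x::t2_space set"
  assumes "\<omega> \<in> positive_measures X" "0 \<le> c"
  shows "tv_norm X (\<lambda>A. c * \<omega> A) = c * tv_norm X \<omega>"
  using assms by (simp add: tv_norm_positive positive_measures_scale)

text \<open>A positive measure equals its variation, so its negative part is the zero measure.\<close>

lemma pairing_positive:
  assumes \<omega>: "\<omega> \<in> positive_measures X"
  shows "pairing X f \<omega> = (\<integral>x. f x \<partial>borel_measure_of X \<omega>)"
proof -
  interpret sigma_algebra X "borel_on X"
    by (rule sigma_algebra_borel_on)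
  note [simp] = sigma_sets_eq total_variation_positive[OF \<omega>]
  have "pos_part X \<omega> = borel_measure_of X \<omega>"
    unfolding pos_part_def borel_measure_of_def
    by (rule measure_of_eq[OF space_closed]) simp
  moreover have "neg_part X \<omega> = null_measure (borel_measure_of X \<omega>)"
    unfolding neg_part_def null_measure_def space_borel_measure_of sets_borel_measure_of
    by (rule measure_of_eq[OF space_closed]) simp
  ultimately show ?thesis
    by (simp add: pairing_def)
qed

lemma pairing_scale:
  fixes X :: "'x::t2_space set"
  assumes \<omega>: "\<omega> \<in> positive_measures X" and c: "0 \<le> c"
  shows "pairing X f (\<lambda>A. c * \<omega> A) = c * pairing X f \<omega>"
proof -
  let ?M = "borel_measure_of X \<omega>"
  have M': "borel_measure_of X (\<lambda>A. c * \<omega> A) = density ?M (\<lambda>_. ennreal c)"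
    using positive_measures_scale[OF \<omega> c] c
    by (intro measure_eqI)
      (simp_all add: emeasure_borel_measure_of[OF \<omega>] emeasure_borel_measure_of emeasure_density_const
        ennreal_mult positive_measures_nonneg[OF \<omega>])
  have "(\<integral>x. f x \<partial>density ?M (\<lambda>_. ennreal c)) = c * (\<integral>x. f x \<partial>?M)"
  proof (cases "f \<in> borel_measurable ?M")
    case True
    then show ?thesis
      using c by (subst integral_density) simp_all
  next
    case False
    \<comment> \<open>The Bochner integral of a non-measurable function is \<open>0\<close> by convention.\<close>
    then have "\<not> integrable ?M f" "\<not> integrable (density ?M (\<lambda>_. ennreal c)) f"
      using borel_measurable_integrable by fastforce+
    then show ?thesis
      by (simp add: not_integrable_integral_eq)
  qed
  then show ?thesis
    using assms by (simp add: pairing_positive positive_measures_scale M')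
qed

section \<open>The information matrix\<close>

lemma info_matrix_scale:
  fixes X :: "'x::t2_space set"
  assumes "\<omega> \<in> positive_measures X" "0 \<le> c"
  shows "info_matrix X dS (\<lambda>A. c * \<omega> A) = c *\<^sub>R info_matrix X dS \<omega>"
  using assms by (simp add: info_matrix_def vec_eq_iff pairing_scale)

lemma info_matrix_Sym: "info_matrix X dS \<omega> \<in> Sym_mats"
  by (simp add: Sym_mats_def info_matrix_def transpose_def vec_eq_iff mult.commute)

text \<open>A positive measure of norm \<open>0\<close> vanishes on every set by monotonicity, so it coincides with its
  own multiple by \<open>0\<close>.\<close>

lemma info_matrix_norm_0:
  fixes X :: "'x::t2_space set"
  assumes \<omega>: "\<omega> \<in> positive_measures X" and "tv_norm X \<omega> = 0"
  shows "info_matrix X dS \<omega> = 0"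
proof -
  interpret finite_measure "borel_measure_of X \<omega>"
    by (rule finite_measure_borel_measure_of[OF \<omega>])
  have "\<omega> A \<le> 0" for A
    using bounded_measure[of A] assms(2) by (simp add: measure_borel_measure_of[OF \<omega>] tv_norm_positive[OF \<omega>])
  then have "\<omega> = (\<lambda>A. 0 * \<omega> A)"
    using positive_measures_nonneg[OF \<omega>] by (auto intro: antisym)
  then show ?thesis
    using info_matrix_scale[OF \<omega>, of 0 dS] by simp
qed

lemma PD_mats_nonzero: "N \<in> PD_mats \<Longrightarrow> N \<noteq> 0"
  using vector_choose_size[of 1] by (fastforce simp: PD_mats_def)

lemma PD_mats_scale: "N \<in> PD_mats \<Longrightarrow> 0 < r \<Longrightarrow> r *\<^sub>R N \<in> PD_mats"
  by (auto simp: PD_mats_def Sym_mats_def transpose_scalar scaleR_matrix_vector_assoc[symmetric])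

section \<open>Scaling solutions of the penalized problem\<close>

theorem proposition3p12:
  fixes \<Omega> \<Omega>\<^sub>o :: "(real^'d) set"
    and Q_ad :: "(real^'n) set" and q_hat :: "real^'n"
    and S :: "real^'n \<Rightarrow> real^'d \<Rightarrow> real"
    and dS :: "'n \<Rightarrow> real^'d \<Rightarrow> real"
    and I0 :: "real^'n^'n"
    and \<Psi> :: "real^'n^'n \<Rightarrow> ereal"
    and \<gamma> :: "real \<Rightarrow> real"
    and K \<beta> :: real
    and \<omega>\<^sub>\<beta> :: "(real^'d) set \<Rightarrow> real"
  assumes domain: "open \<Omega>" "connected \<Omega>" "\<Omega> \<noteq> {}" "bounded \<Omega>"
    and observation: "\<Omega>\<^sub>o \<subseteq> closure \<Omega>" "\<Omega>\<^sub>o \<noteq> {}" "closed \<Omega>\<^sub>o"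
    and S_C1: "C1_near \<Omega>\<^sub>o S Q_ad"
    and q_hat: "q_hat \<in> Q_ad"
    and partials: "\<And>k. has_C_partial \<Omega>\<^sub>o S k (dS k) q_hat"
    and I0_NND: "I0 \<in> NND_mats"
    and \<Psi>_range: "\<And>N. N \<in> Sym_mats \<Longrightarrow> \<Psi> N \<noteq> -\<infinity>"
    and A1: "{N \<in> Sym_mats. \<Psi> N < \<infinity>} = PD_mats"
    and A2: "C1_on_PD \<Psi>"
    and A3: "\<And>N. N \<in> NND_mats \<Longrightarrow> 0 \<le> \<Psi> N"
    and A4: "lsc_on NND_mats \<Psi>" "ereal_convex_on NND_mats \<Psi>"
    and A5: "\<And>N1 N2. N1 \<in> NND_mats \<Longrightarrow> N2 \<in> NND_mats \<Longrightarrow> loewner_le N1 N2 \<Longrightarrow> \<Psi> N2 \<le> \<Psi> N1"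
    and I0_zero: "I0 = 0"
    and \<gamma>_pos: "\<And>r. 0 < r \<Longrightarrow> 0 < \<gamma> r"
    and \<gamma>_convex: "convex_on {0<..} \<gamma>"
    and \<gamma>_decreasing: "strict_antimono_on {0<..} \<gamma>"
    and homogeneous: "\<And>r N. 0 < r \<Longrightarrow> N \<in> PD_mats \<Longrightarrow> \<Psi> (r *\<^sub>R N) = ereal (\<gamma> r) * \<Psi> N"
    and K_pos: "0 < K"
    and \<beta>_pos: "0 < \<beta>"
    and sol: "solves_P_beta \<Omega>\<^sub>o dS \<Psi> I0 \<beta> \<omega>\<^sub>\<beta>"
  shows "solves_P_K \<Omega>\<^sub>o dS \<Psi> I0 K (\<lambda>A. K * \<omega>\<^sub>\<beta> A / tv_norm \<Omega>\<^sub>o \<omega>\<^sub>\<beta>)"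
proof -
  let ?X = \<Omega>\<^sub>o and ?\<omega> = \<omega>\<^sub>\<beta>
  let ?\<I> = "info_matrix ?X dS"
  define m where "m = tv_norm ?X ?\<omega>"
  define \<omega>' where "\<omega>' = (\<lambda>A. (K / m) * ?\<omega> A)"
  have \<omega>: "?\<omega> \<in> positive_measures ?X"
    and finite: "\<bar>\<Psi> (?\<I> ?\<omega>) + ereal (\<beta> * m)\<bar> \<noteq> \<infinity>"
    and minimal: "\<And>\<nu>. \<nu> \<in> positive_measures ?X \<Longrightarrow>
      \<Psi> (?\<I> ?\<omega>) + ereal (\<beta> * m) \<le> \<Psi> (?\<I> \<nu>) + ereal (\<beta> * tv_norm ?X \<nu>)"
    using sol by (auto simp: solves_P_beta_def is_solution_def design_obj_def I0_zero m_def)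
  have PD_iff: "?\<I> \<mu> \<in> PD_mats \<longleftrightarrow> \<Psi> (?\<I> \<mu>) < \<infinity>" for \<mu>
    using A1 info_matrix_Sym by blast
  have \<Psi>_fin: "\<bar>\<Psi> (?\<I> ?\<omega>)\<bar> \<noteq> \<infinity>"
    using finite by (cases "\<Psi> (?\<I> ?\<omega>)") auto
  then have PD: "?\<I> ?\<omega> \<in> PD_mats"
    unfolding PD_iff by (cases "\<Psi> (?\<I> ?\<omega>)") auto
  have m_pos: "0 < m"
    using PD PD_mats_nonzero info_matrix_norm_0[OF \<omega>] positive_measures_nonneg[OF \<omega>]
    unfolding m_def tv_norm_positive[OF \<omega>] by (metis less_eq_real_def)
  have \<omega>'_val: "\<Psi> (?\<I> \<omega>') = ereal (\<gamma> (K / m)) * \<Psi> (?\<I> ?\<omega>)"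
    using m_pos K_pos PD unfolding \<omega>'_def
    by (subst info_matrix_scale[OF \<omega>]) (simp_all add: homogeneous)
  have \<omega>'_pos: "\<omega>' \<in> positive_measures ?X"
    using m_pos K_pos unfolding \<omega>'_def by (intro positive_measures_scale[OF \<omega>]) simp
  have \<omega>'_norm: "tv_norm ?X \<omega>' = K"
    using m_pos K_pos unfolding \<omega>'_def
    by (subst tv_norm_scale[OF \<omega>]) (simp_all flip: m_def)
  have optimal: "\<Psi> (?\<I> \<omega>') \<le> \<Psi> (?\<I> \<mu>)"
    if \<mu>: "\<mu> \<in> positive_measures ?X" and \<mu>_le: "tv_norm ?X \<mu> \<le> K" for \<mu>
  proof (cases "?\<I> \<mu> \<in> PD_mats")
    case False
    then show ?thesis
      by (simp add: PD_iff)
  next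
    case True
    define \<nu> where "\<nu> = (\<lambda>A. (m / K) * \<mu> A)"
    have \<nu>: "\<nu> \<in> positive_measures ?X"
      using m_pos K_pos unfolding \<nu>_def by (intro positive_measures_scale[OF \<mu>]) simp
    have \<nu>_info: "?\<I> \<nu> = (m / K) *\<^sub>R ?\<I> \<mu>"
      using m_pos K_pos unfolding \<nu>_def by (intro info_matrix_scale[OF \<mu>]) simp
    have "tv_norm ?X \<nu> = (m / K) * tv_norm ?X \<mu>"
      using m_pos K_pos unfolding \<nu>_def by (intro tv_norm_scale[OF \<mu>]) simp
    also have "\<dots> \<le> (m / K) * K"
      using m_pos K_pos \<mu>_le by (intro mult_left_mono) simp_all
    finally have "tv_norm ?X \<nu> \<le> m"
      using K_pos by simp
    then have "\<Psi> (?\<I> \<nu>) + ereal (\<beta> * tv_norm ?X \<nu>) \<le> \<Psi> (?\<I> \<nu>) + ereal (\<beta> * m)"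
      using \<beta>_pos by (intro add_left_mono) simp
    with minimal[OF \<nu>] have "\<Psi> (?\<I> ?\<omega>) + ereal (\<beta> * m) \<le> \<Psi> (?\<I> \<nu>) + ereal (\<beta> * m)"
      by (rule order_trans)
    then have "\<Psi> (?\<I> ?\<omega>) \<le> \<Psi> (?\<I> \<nu>)"
      by (cases "\<Psi> (?\<I> ?\<omega>)"; cases "\<Psi> (?\<I> \<nu>)") auto
    then have "\<Psi> (?\<I> \<omega>') \<le> ereal (\<gamma> (K / m)) * \<Psi> (?\<I> \<nu>)"
      using \<gamma>_pos[of "K / m"] m_pos K_pos unfolding \<omega>'_val by (intro ereal_mult_left_mono) simp_all
    also have "\<dots> = \<Psi> ((K / m) *\<^sub>R ?\<I> \<nu>)"
      using m_pos K_pos unfolding \<nu>_info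
      by (intro homogeneous[symmetric] PD_mats_scale[OF True]) simp_all
    also have "\<dots> = \<Psi> (?\<I> \<mu>)"
      using m_pos K_pos by (simp add: \<nu>_info)
    finally show ?thesis .
  qed
  have "\<bar>\<Psi> (?\<I> \<omega>')\<bar> \<noteq> \<infinity>"
    using \<Psi>_fin unfolding \<omega>'_val by (cases "\<Psi> (?\<I> ?\<omega>)") auto
  then have "solves_P_K ?X dS \<Psi> I0 K \<omega>'"
    using \<omega>'_pos \<omega>'_norm optimal
    by (simp add: solves_P_K_def is_solution_def design_obj_def I0_zero)
  then show ?thesis
    by (simp add: \<omega>'_def m_def)
qed

end
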